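(* Let $\mathbf X\in\mathbb R^{n\times d}$ be a full rank matrix with rows $\mathbf x_1^\top,\dots,\mathbf x_n^\top$, and let $s\in\{d,\dots,n\}$. If $S\subseteq\{1,\dots,n\}$ is sampled according to size $s$ volume sampling from $\mathbf X$, then for any $i\in\{1,\dots,n\}$, $$P(i\in S)=\frac{s-d}{n-d}+\frac{n-s}{n-d}\,\mathbf x_i^\top(\mathbf X^\top\mathbf X)^{-1}\mathbf x_i.$$
   Context: Here $n\ge d$, so full rank means rank $d$. $\mathbf X_S$ is the submatrix of the rows of $\mathbf X$ indexed by $S$. Size $s$ volume sampling from $\mathbf X$ selects a set $S\subseteq\{1,\dots,n\}$ with $|S|=s$ with probability $P(S)=\dfrac{\det(\mathbf X_S^\top\mathbf X_S)}{\binom{n-d}{s-d}\det(\mathbf X^\top\mathbf X)}$. The quantity $\mathbf x_i^\top(\mathbf X^\top\mathbf X)^{-1}\mathbf x_i$ is called the leverage score $l_i$ of the $i$-th row.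
   Formalization: The formal statement assumes n > d; for n = d (which forces s = d = n) both fractions in the formula are 0/0, so the right-hand side is undefined in that single excluded case. *)

theory Defs
  imports
    "HOL-Probability.Probability_Mass_Function"
    "Jordan_Normal_Form.DL_Rank"
    "Jordan_Normal_Form.DL_Submatrix"
    "Jordan_Normal_Form.Gauss_Jordan_Elimination"
begin

hide_const (open) Determinants.det Finite_Cartesian_Product.row
  Finite_Cartesian_Product.transpose

no_notation inner (infix \<open>\<bullet>\<close> 70)

(* Rows are indexed by {0..<dim_row X}, following the matrix library. *)

definition row_submatrix :: "'a mat \<Rightarrow> nat set \<Rightarrow> 'a mat" where
  "row_submatrix X S = submatrix X S UNIV"

definition volume_prob :: "real mat \<Rightarrow> nat \<Rightarrow> nat set \<Rightarrow> real" where
  "volume_prob X s S =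
    (if S \<subseteq> {0..<dim_row X} \<and> card S = s
     then Determinant.det (transpose_mat (row_submatrix X S) * row_submatrix X S) /
       (real ((dim_row X - dim_col X) choose (s - dim_col X)) *
        Determinant.det (transpose_mat X * X))
     else 0)"

(* volume_prob X s is a probability mass function when X has full column rank and
   dim_col X \<le> s \<le> dim_row X; otherwise embed_pmf yields an unspecified value. *)
definition volume_sampling :: "real mat \<Rightarrow> nat \<Rightarrow> nat set pmf" where
  "volume_sampling X s = embed_pmf (volume_prob X s)"

(* The inverse exists when X has full column rank; otherwise mat_inverse is None and
   the value is unspecified. *)
definition leverage_score :: "real mat \<Rightarrow> nat \<Rightarrow> real" where
  "leverage_score X i =
    Matrix.row X i \<bullet> (the (mat_inverse (transpose_mat X * X)) *\<^sub>v Matrix.row X i)"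

end

(* Write g S for det (X_S^T X_S). By the rank-one update formula, in its division-free form with
   cofactors, and Laplace expansion, the sum of g (S - {i}) over i in S is (card S - d) g S, even
   when the Gram matrix is singular. Downward induction on s then gives that the g S with
   S a subset of T of size s sum to ((card T - d) choose (s - d)) g T. For T = {0..<n} this
   normalizes the distribution, for s = d it is Cauchy-Binet and yields g >= 0, and for
   T = {0..<n} - {i}, where g T = (1 - l_i) g {0..<n}, it evaluates the probability of i not in S. *)
theory Submission
  imports Defs
begin

section \<open>Gram matrices of row sets and the rank-one determinant update\<close>

text \<open>A sum of outer products over \<open>S\<close> makes the deletion of a row a rank-one
  change, and no enumeration of \<open>S\<close> is needed.\<close>

definition gram :: "'a::comm_ring_1 mat \<Rightarrow> nat set \<Rightarrow> 'a mat" where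
  "gram X S = mat (dim_col X) (dim_col X) (\<lambda>(a,b). \<Sum>k\<in>S. X $$ (k,a) * X $$ (k,b))"

lemma gram_carrier [simp]: "gram X S \<in> carrier_mat (dim_col X) (dim_col X)"
  by (simp add: gram_def)

lemma cofactor_eq_if_other_rows_eq:
  assumes "A \<in> carrier_mat n n" "B \<in> carrier_mat n n"
    and "\<And>i j. i < n \<Longrightarrow> j < n \<Longrightarrow> i \<noteq> k \<Longrightarrow> A $$ (i,j) = B $$ (i,j)"
  shows "cofactor A k l = cofactor B k l"
proof -
  have "mat_delete A k l = mat_delete B k l"
    using assms by (intro eq_matI) (auto simp: mat_delete_def)
  then show ?thesis by (simp add: cofactor_def)
qed

text \<open>One step of a row-by-row update: with \<open>c = x k\<close> the left side is the
  Laplace expansion of the matrix whose rows up to \<open>k\<close> are updated. The part with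
  \<open>y\<close> is a determinant whose row \<open>k\<close> is \<open>y\<close>, and subtracting
  multiples of that row undoes the updates in the earlier rows.\<close>

lemma sum_cofactor_row_update:
  fixes A :: "'a::comm_ring_1 mat"
  assumes A: "A \<in> carrier_mat n n" and k: "k < n"
  shows "(\<Sum>b<n. (A $$ (k,b) + c * y b) * cofactor (mat n n (\<lambda>(a,b). if a < k then A $$ (a,b) + x a * y b else A $$ (a,b))) k b)
    = Determinant.det (mat n n (\<lambda>(a,b). if a < k then A $$ (a,b) + x a * y b else A $$ (a,b)))
      + c * (\<Sum>b<n. y b * cofactor A k b)"
proof -
  define M where "M = mat n n (\<lambda>(a,b). if a < k then A $$ (a,b) + x a * y b else A $$ (a,b))"
  define N where "N = mat n n (\<lambda>(a,b). if a = k then y b else A $$ (a,b))"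
  define N' where "N' = mat n n (\<lambda>(a,b). if a = k then y b else M $$ (a,b))"
  \<comment> \<open>\<open>E\<close> is unit upper triangular and adds \<open>x a\<close> times row
    \<open>k\<close> to each row \<open>a < k\<close>. Row \<open>k\<close> of \<open>N\<close> is
    \<open>y\<close>, so this recreates the updates of \<open>M\<close>.\<close>
  define E where "E = mat n n (\<lambda>(a,b). if a = b then 1 else if a < k \<and> b = k then x a else 0)"
  have M: "M \<in> carrier_mat n n" and N: "N \<in> carrier_mat n n" and N': "N' \<in> carrier_mat n n"
    and E: "E \<in> carrier_mat n n"
    by (simp_all add: M_def N_def N'_def E_def)
  have EN: "E * N = N'"
  proof (rule eq_matI)
    fix a b assume "a < dim_row N'" "b < dim_col N'"
    then have ab: "a < n" "b < n" using N' by auto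
    have "(E * N) $$ (a,b) = (\<Sum>j<n. E $$ (a,j) * N $$ (j,b))"
      using ab E N by (auto simp: scalar_prod_def atLeast0LessThan)
    also have "\<dots> = (\<Sum>j<n. (if j = a then N $$ (a,b) else 0) + (if j = k then (if a < k then x a * y b else 0) else 0))"
      using ab k by (intro sum.cong) (auto simp: E_def N_def)
    also have "\<dots> = N $$ (a,b) + (if a < k then x a * y b else 0)"
      using ab k by (simp add: sum.distrib)
    also have "\<dots> = N' $$ (a,b)"
      using ab k by (auto simp: N_def N'_def M_def)
    finally show "(E * N) $$ (a,b) = N' $$ (a,b)" .
  qed (use E N N' in auto)
  have "Determinant.det E = prod_list (diag_mat E)"
    by (rule det_upper_triangular[OF _ E]) (auto simp: E_def upper_triangular_def)
  also have "diag_mat E = map (\<lambda>_. 1) [0..<n]"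
    by (simp add: diag_mat_def E_def)
  also have "prod_list \<dots> = (1::'a)"
    by (simp add: map_replicate_const)
  finally have det_eq: "Determinant.det N' = Determinant.det N"
    using det_mult[OF E N] EN by simp
  \<comment> \<open>Cofactors along row \<open>k\<close> do not see row \<open>k\<close>, so
    \<open>M\<close> can be traded for \<open>N'\<close> and \<open>N\<close> for \<open>A\<close>;
    in between, both sums are equal determinants.\<close>
  have "(\<Sum>b<n. y b * cofactor M k b) = (\<Sum>b<n. N' $$ (k,b) * cofactor N' k b)"
    using k by (intro sum.cong arg_cong2[where f="(*)"] cofactor_eq_if_other_rows_eq[OF M N']) (auto simp: N'_def)
  also have "\<dots> = (\<Sum>b<n. N $$ (k,b) * cofactor N k b)"
    using laplace_expansion_row[OF N' k] laplace_expansion_row[OF N k] det_eq by simp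
  also have "\<dots> = (\<Sum>b<n. y b * cofactor A k b)"
    using k by (intro sum.cong arg_cong2[where f="(*)"] cofactor_eq_if_other_rows_eq[OF N A]) (auto simp: N_def)
  finally have y: "(\<Sum>b<n. y b * cofactor M k b) = (\<Sum>b<n. y b * cofactor A k b)" .
  have "Determinant.det M = (\<Sum>b<n. A $$ (k,b) * cofactor M k b)"
    unfolding laplace_expansion_row[OF M k] using k by (intro sum.cong) (auto simp: M_def)
  then show ?thesis
    unfolding M_def[symmetric] y[symmetric]
    by (simp add: distrib_right sum.distrib sum_distrib_left mult.assoc)
qed

text \<open>The matrix determinant lemma det(A + x y^T) = det A + y^T adj(A) x, free of inverses.
  Rows are updated one at a time: \<open>M k\<close> below has its first \<open>k\<close> rows
  updated.\<close>

lemma det_rank_one_update: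
  fixes A :: "'a::comm_ring_1 mat"
  assumes A: "A \<in> carrier_mat n n"
  shows "Determinant.det (mat n n (\<lambda>(a,b). A $$ (a,b) + x a * y b))
    = Determinant.det A + (\<Sum>a<n. x a * (\<Sum>b<n. y b * cofactor A a b))"
proof -
  define M where "M k = mat n n (\<lambda>(a,b). if a < k then A $$ (a,b) + x a * y b else A $$ (a,b))" for k
  have "k \<le> n \<Longrightarrow> Determinant.det (M k)
      = Determinant.det A + (\<Sum>a<k. x a * (\<Sum>b<n. y b * cofactor A a b))" for k
  proof (induction k)
    case 0
    have "M 0 = A" using A by (intro eq_matI) (auto simp: M_def)
    then show ?case by simp
  next
    case (Suc k)
    then have k: "k < n" by simp
    have M: "M l \<in> carrier_mat n n" for l by (simp add: M_def)
    have "Determinant.det (M (Suc k)) = (\<Sum>b<n. (A $$ (k,b) + x k * y b) * cofactor (M k) k b)"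
      unfolding laplace_expansion_row[OF M k] using k
      by (intro sum.cong arg_cong2[where f="(*)"] cofactor_eq_if_other_rows_eq[OF M M])
        (auto simp: M_def)
    also have "\<dots> = Determinant.det (M k) + x k * (\<Sum>b<n. y b * cofactor A k b)"
      unfolding M_def by (rule sum_cofactor_row_update[OF A k])
    finally show ?case using Suc by simp
  qed
  moreover have "M n = mat n n (\<lambda>(a,b). A $$ (a,b) + x a * y b)"
    by (intro eq_matI) (auto simp: M_def)
  ultimately show ?thesis by (metis order_refl)
qed

section \<open>Deleting a row from a Gram determinant\<close>

lemma det_gram_remove:
  assumes "finite S" "i \<in> S"
  shows "Determinant.det (gram X (S - {i})) = Determinant.det (gram X S)
    - (\<Sum>a<dim_col X. \<Sum>b<dim_col X. X $$ (i,a) * X $$ (i,b) * cofactor (gram X S) a b)"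
proof -
  have "gram X (S - {i}) = mat (dim_col X) (dim_col X)
      (\<lambda>(a,b). gram X S $$ (a,b) + (- X $$ (i,a)) * X $$ (i,b))"
    using assms by (intro eq_matI) (auto simp: gram_def sum_diff1)
  then show ?thesis
    by (simp only: det_rank_one_update[OF gram_carrier])
      (simp add: sum_distrib_left sum_negf mult.assoc)
qed

text \<open>Summed over \<open>i\<close>, the products of row entries rebuild the Gram matrix A, so
  the total correction is the trace of A adj(A), which is d times det A. The subtraction takes place
  in the ring and is not truncated.\<close>

lemma sum_det_gram_remove:
  assumes "finite S"
  shows "(\<Sum>i\<in>S. Determinant.det (gram X (S - {i})))
    = (of_nat (card S) - of_nat (dim_col X)) * Determinant.det (gram X S)"
proof -
  let ?d = "dim_col X" and ?A = "gram X S"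
  have "(\<Sum>i\<in>S. \<Sum>a<?d. \<Sum>b<?d. X $$ (i,a) * X $$ (i,b) * cofactor ?A a b)
      = (\<Sum>a<?d. \<Sum>b<?d. \<Sum>i\<in>S. X $$ (i,a) * X $$ (i,b) * cofactor ?A a b)"
    by (subst sum.swap) (intro sum.cong refl sum.swap)
  also have "\<dots> = (\<Sum>a<?d. \<Sum>b<?d. ?A $$ (a,b) * cofactor ?A a b)"
    by (intro sum.cong refl) (auto simp: gram_def sum_distrib_right)
  also have "\<dots> = (\<Sum>a<?d. Determinant.det ?A)"
    by (intro sum.cong refl laplace_expansion_row[OF gram_carrier, symmetric]) simp
  finally show ?thesis
    using assms by (simp add: det_gram_remove sum_subtractf algebra_simps)
qed

section \<open>Sums over subsets of a fixed size\<close>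

text \<open>Double counting: pairs (S, i) with i in S match pairs (R, i) with R = S - {i} and i in T
  - R, so each R occurs \<open>card T - s\<close> times.\<close>

lemma sum_subsets_card_Suc_remove:
  fixes g :: "'b set \<Rightarrow> 'a::comm_ring_1"
  assumes "finite T" "s \<le> card T"
  shows "(\<Sum>S | S \<subseteq> T \<and> card S = Suc s. \<Sum>i\<in>S. g (S - {i}))
    = of_nat (card T - s) * (\<Sum>S | S \<subseteq> T \<and> card S = s. g S)"
proof -
  let ?P = "\<lambda>s. {S. S \<subseteq> T \<and> card S = s}"
  have fin: "finite (?P k)" for k using assms by simp
  have finS: "finite S" if "S \<subseteq> T" for S using that assms(1) by (rule finite_subset)
  have "(\<Sum>S\<in>?P (Suc s). \<Sum>i\<in>S. g (S - {i})) = (\<Sum>(S,i)\<in>(SIGMA S:?P (Suc s). S). g (S - {i}))"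
    by (rule sum.Sigma[OF fin]) (use finS in blast)
  also have "\<dots> = (\<Sum>(R,i)\<in>(SIGMA R:?P s. T - R). g R)"
    using finS
    by (intro sum.reindex_bij_witness[where i="\<lambda>(R,i). (insert i R, i)" and j="\<lambda>(S,i). (S - {i}, i)"])
      (auto simp: card_insert_if)
  also have "\<dots> = (\<Sum>R\<in>?P s. \<Sum>i\<in>T - R. g R)"
    by (rule sum.Sigma[OF fin, symmetric]) (use assms in blast)
  also have "\<dots> = (\<Sum>R\<in>?P s. of_nat (card T - s) * g R)"
    using assms by (intro sum.cong refl) (simp add: card_Diff_subset finS)
  finally show ?thesis by (simp add: sum_distrib_left)
qed

text \<open>With n = \<open>card T\<close> and F(s) the left side, double counting gives (n - s)
  F(s) = (s + 1 - d) F(s + 1), the recurrence of the binomial coefficients. Characteristic 0 allows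
  cancelling n - s for s < n.\<close>

lemma sum_det_gram_subsets:
  fixes X :: "'a::field_char_0 mat"
  assumes T: "finite T" and d: "dim_col X \<le> card T" "dim_col X \<le> s"
  shows "(\<Sum>S | S \<subseteq> T \<and> card S = s. Determinant.det (gram X S))
    = of_nat ((card T - dim_col X) choose (s - dim_col X)) * Determinant.det (gram X T)"
proof (cases "s \<le> card T")
  case False
  then have empty: "{S. S \<subseteq> T \<and> card S = s} = {}" using card_mono[OF T] by auto
  \<comment> \<open>Since d is at most \<open>card T\<close>, the truncated difference
    \<open>card T - dim_col X\<close> is below \<open>s - dim_col X\<close> and the binomial
    coefficient vanishes.\<close>
  show ?thesis unfolding empty using False d by (simp add: binomial_eq_0)
next
  case True
  let ?d = "dim_col X" and ?n = "card T"
  let ?F = "\<lambda>s. \<Sum>S | S \<subseteq> T \<and> card S = s. Determinant.det (gram X S)"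
  from True show ?thesis using d(2)
  proof (induction s rule: inc_induct)
    case base
    have "{S. S \<subseteq> T \<and> card S = ?n} = {T}"
      using T card_subset_eq by auto
    then show ?case by simp
  next
    case (step s)
    have "of_nat (?n - s) * ?F s
        = (\<Sum>S | S \<subseteq> T \<and> card S = Suc s. \<Sum>i\<in>S. Determinant.det (gram X (S - {i})))"
      using step T by (intro sum_subsets_card_Suc_remove[symmetric]) auto
    also have "\<dots> = (\<Sum>S | S \<subseteq> T \<and> card S = Suc s. of_nat (Suc s - ?d) * Determinant.det (gram X S))"
      using T step by (intro sum.cong refl) (simp add: sum_det_gram_remove finite_subset[OF _ T] of_nat_diff del: of_nat_Suc)
    also have "\<dots> = of_nat (Suc s - ?d) * ?F (Suc s)"
      by (simp add: sum_distrib_left)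
    also have "\<dots> = of_nat ((Suc s - ?d) * ((?n - ?d) choose (Suc s - ?d))) * Determinant.det (gram X T)"
      using step by simp
    \<comment> \<open>With m = n - d and k = s - d: (k + 1) C(m, k + 1) = (m - k) C(m, k).\<close>
    also have "(Suc s - ?d) * ((?n - ?d) choose (Suc s - ?d)) = (?n - s) * ((?n - ?d) choose (s - ?d))"
    proof -
      have *: "Suc s - ?d = Suc (s - ?d)" "?n - s = (?n - ?d) - (s - ?d)" using step by auto
      show ?thesis unfolding *
        by (metis binomial_absorb_comp binomial_absorption)
    qed
    finally show ?case using step by (simp add: mult.assoc)
  qed
qed

section \<open>Row submatrices and nonnegativity\<close>

text \<open>\<open>submatrix\<close> lists the rows through \<open>pick S\<close>, a bijection from
  \<open>{..<card S}\<close> onto \<open>S\<close>; reindexing the sum along it suffices.\<close>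

lemma gram_eq_row_submatrix:
  assumes "S \<subseteq> {0..<dim_row X}"
  shows "gram X S = transpose_mat (row_submatrix X S) * row_submatrix X S"
proof -
  have S: "{i. i < dim_row X \<and> i \<in> S} = S" using assms by auto
  have fin: "finite S" using assms finite_subset by blast
  have bij: "bij_betw (pick S) {..<card S} S"
  proof (rule bij_betw_imageI)
    show "inj_on (pick S) {..<card S}"
      using pick_mono_le[of _ S] by (intro linorder_inj_onI') (metis lessThan_iff less_irrefl)
    then show "pick S ` {..<card S} = S"
      by (intro card_subset_eq fin) (auto simp: card_image pick_in_set_le)
  qed
  show ?thesis
  proof (rule eq_matI)
    fix a b assume "a < dim_row (transpose_mat (row_submatrix X S) * row_submatrix X S)"
      "b < dim_col (transpose_mat (row_submatrix X S) * row_submatrix X S)"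
    then have ab: "a < dim_col X" "b < dim_col X"
      by (auto simp: row_submatrix_def dim_submatrix)
    have "(transpose_mat (row_submatrix X S) * row_submatrix X S) $$ (a,b)
        = (\<Sum>k<card S. X $$ (pick S k, a) * X $$ (pick S k, b))"
      using ab by (auto simp: row_submatrix_def submatrix_def scalar_prod_def S pick_UNIV
        atLeast0LessThan intro!: sum.cong)
    also have "\<dots> = gram X S $$ (a,b)"
      using ab sum.reindex_bij_betw[OF bij, of "\<lambda>k. X $$ (k,a) * X $$ (k,b)"]
      by (simp add: gram_def)
    finally show "gram X S $$ (a,b) = (transpose_mat (row_submatrix X S) * row_submatrix X S) $$ (a,b)"
      by simp
  qed (auto simp: row_submatrix_def dim_submatrix gram_def)
qed

lemma gram_all_rows: "gram X {0..<dim_row X} = transpose_mat X * X"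
  by (intro eq_matI) (auto simp: gram_def scalar_prod_def)

text \<open>Cauchy-Binet: for subsets of size d the binomial coefficient is 1, so the determinant is
  a sum of squares of d by d minors.\<close>

lemma det_gram_nonneg:
  fixes X :: "real mat"
  assumes S: "S \<subseteq> {0..<dim_row X}" and d: "dim_col X \<le> card S"
  shows "Determinant.det (gram X S) \<ge> 0"
proof -
  have fin: "finite S" using S finite_subset by blast
  have "Determinant.det (gram X R) \<ge> 0" if R: "R \<subseteq> S" "card R = dim_col X" for R
  proof -
    have "{i. i < dim_row X \<and> i \<in> R} = R" using R S by auto
    then have sq: "row_submatrix X R \<in> carrier_mat (dim_col X) (dim_col X)"
      using R by (auto simp: row_submatrix_def dim_submatrix)
    have "Determinant.det (gram X R) = (Determinant.det (row_submatrix X R))\<^sup>2"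
      using gram_eq_row_submatrix[of R X] R S sq
      by (simp add: det_mult[of _ "dim_col X"] det_transpose[OF sq] power2_eq_square)
    then show ?thesis by simp
  qed
  then have "0 \<le> (\<Sum>R | R \<subseteq> S \<and> card R = dim_col X. Determinant.det (gram X R))"
    by (intro sum_nonneg) auto
  also have "\<dots> = Determinant.det (gram X S)"
    using sum_det_gram_subsets[OF fin d, of "dim_col X"] by simp
  finally show ?thesis .
qed

section \<open>Full column rank and invertibility of the Gram matrix\<close>

context vec_space
begin

text \<open>The rank is the size of a maximal independent subset of the set of columns, hence at
  most the number of distinct columns. Distinctness turns a kernel vector into a linear relation on
  that set.\<close>

lemma full_column_rank_distinct_cols:
  assumes A: "A \<in> carrier_mat n nc" and "rank A = nc"
  shows "distinct (cols A)"
proof -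
  obtain S where S: "maximal S (\<lambda>T. T \<subseteq> set (cols A) \<and> lin_indpt T)"
    using maximal_exists[of "(\<lambda>T. T \<subseteq> set (cols A) \<and> lin_indpt T)" "card (set (cols A))" "{}"]
    by (meson List.finite_set card_mono empty_iff empty_subsetI finite_lin_indpt2 rev_finite_subset)
  then have "card S \<le> card (set (cols A))" by (simp add: card_mono maximal_def)
  then have "length (cols A) \<le> card (set (cols A))"
    using rank_card_indpt[OF A S] assms by simp
  then show ?thesis using card_length[of "cols A"] by (intro card_distinct) simp
qed

lemma full_column_rank_kernel:
  assumes "A \<in> carrier_mat n nc" "rank A = nc" "v \<in> carrier_vec nc" "A *\<^sub>v v = 0\<^sub>v n"
  shows "v = 0\<^sub>v nc"
proof (rule ccontr)
  note distinct = full_column_rank_distinct_cols[OF assms(1,2)]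
  assume "v \<noteq> 0\<^sub>v nc"
  then have "lin_dep (set (cols A))"
    by (rule lin_depI[OF assms(1,3) _ assms(4) distinct])
  then show False
    using full_rank_lin_indpt[OF assms(1,2) distinct] by contradiction
qed

end

text \<open>If X^T X v = 0 then Xv has squared norm 0, so Xv = 0 and full rank forces v = 0.\<close>

lemma det_transpose_mult_self_nonzero:
  fixes X :: "real mat"
  assumes X: "X \<in> carrier_mat n d" and rank: "vec_space.rank n X = d"
  shows "Determinant.det (transpose_mat X * X) \<noteq> 0"
proof
  assume "Determinant.det (transpose_mat X * X) = 0"
  then obtain v where v: "v \<in> carrier_vec d" "v \<noteq> 0\<^sub>v d" "(transpose_mat X * X) *\<^sub>v v = 0\<^sub>v d"
    using det_0_iff_vec_prod_zero_field[of "transpose_mat X * X" d] X by auto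
  have Xv: "X *\<^sub>v v \<in> carrier_vec n" using X v by auto
  have "(X *\<^sub>v v) \<bullet> (X *\<^sub>v v) = v \<bullet> (transpose_mat X *\<^sub>v (X *\<^sub>v v))"
    using X v Xv transpose_vec_mult_scalar[OF X v(1) Xv]
    by (simp add: comm_scalar_prod[of _ d])
  also have "transpose_mat X *\<^sub>v (X *\<^sub>v v) = 0\<^sub>v d"
    using v X by (simp add: assoc_mult_mat_vec[of _ d n _ d])
  finally have "(X *\<^sub>v v) \<bullet> (X *\<^sub>v v) = 0" using v by simp
  then have "\<forall>j<n. (X *\<^sub>v v) $ j = 0"
    using X by (simp add: scalar_prod_def sum_nonneg_eq_0_iff del: index_mult_mat_vec)
  then have "X *\<^sub>v v = 0\<^sub>v n"
    using X by (intro eq_vecI) auto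
  then show False using vec_space.full_column_rank_kernel[OF X rank v(1)] v(2) by simp
qed

section \<open>Leverage scores from Gram determinants\<close>

text \<open>For invertible A the adjugate is det A times the inverse, so the cofactor form in
  \<open>det_gram_remove\<close> becomes det A times the leverage score.\<close>

lemma det_gram_remove_leverage:
  fixes X :: "real mat"
  assumes nz: "Determinant.det (transpose_mat X * X) \<noteq> 0" and i: "i < dim_row X"
  shows "Determinant.det (gram X ({0..<dim_row X} - {i}))
    = Determinant.det (transpose_mat X * X) * (1 - leverage_score X i)"
proof -
  let ?d = "dim_col X" and ?A = "transpose_mat X * X"
  have A: "?A \<in> carrier_mat ?d ?d" by (intro carrier_matI) auto
  \<comment> \<open>The unit value fixes the arbitrary extension field of the matrix ring, so that
    both facts concern the same ring.\<close>
  obtain C where C: "mat_inverse ?A = Some C"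
    using mat_inverse(1)[OF A, of "()"] det_non_zero_imp_unit[OF A nz, of "()"] by (cases "mat_inverse ?A") auto
  then have CA: "C * ?A = 1\<^sub>m ?d" "C \<in> carrier_mat ?d ?d" using mat_inverse(2)[OF A C] by auto
  note adj = adj_mat[OF A]
  have "adj_mat ?A = C * ?A * adj_mat ?A" using CA adj by simp
  also have "\<dots> = C * (?A * adj_mat ?A)" using CA A adj by (intro assoc_mult_mat)
  also have "\<dots> = Determinant.det ?A \<cdot>\<^sub>m C"
    using CA unfolding adj(2) by (simp add: mult_smult_distrib[OF CA(2) one_carrier_mat])
  finally have "adj_mat ?A $$ (b,a) = Determinant.det ?A * C $$ (b,a)" if "a < ?d" "b < ?d" for a b
    using CA that by simp
  \<comment> \<open>The adjugate is the transposed cofactor matrix, hence the swapped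
    indices.\<close>
  then have cof: "cofactor ?A a b = Determinant.det ?A * C $$ (b,a)" if "a < ?d" "b < ?d" for a b
    using that by (simp add: adj_mat_def)
  have "(\<Sum>a<?d. \<Sum>b<?d. X $$ (i,a) * X $$ (i,b) * cofactor ?A a b)
      = Determinant.det ?A * (\<Sum>a<?d. \<Sum>b<?d. X $$ (i,b) * (C $$ (b,a) * X $$ (i,a)))"
    by (auto simp: sum_distrib_left cof mult_ac intro!: sum.cong)
  also have "(\<Sum>a<?d. \<Sum>b<?d. X $$ (i,b) * (C $$ (b,a) * X $$ (i,a))) = leverage_score X i"
    using i CA by (subst sum.swap)
      (auto simp: leverage_score_def C scalar_prod_def sum_distrib_left atLeast0LessThan intro!: sum.cong)
  finally show ?thesis
    using det_gram_remove[of "{0..<dim_row X}" i X] i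
    by (simp add: gram_all_rows right_diff_distrib)
qed

section \<open>The volume sampling distribution\<close>

lemma volume_prob_gram:
  "volume_prob X s S =
    (if S \<subseteq> {0..<dim_row X} \<and> card S = s
     then Determinant.det (gram X S) /
       (real ((dim_row X - dim_col X) choose (s - dim_col X)) * Determinant.det (gram X {0..<dim_row X}))
     else 0)"
  by (simp add: volume_prob_def gram_eq_row_submatrix gram_all_rows)

text \<open>\<open>embed_pmf\<close> is faithful on nonnegative functions of total mass 1.
  Nonnegativity comes from Cauchy-Binet, the mass from the subset sum with all rows as
  \<open>T\<close>.\<close>

lemma pmf_volume_sampling:
  assumes nz: "Determinant.det (transpose_mat X * X) \<noteq> 0"
    and s: "dim_col X \<le> s" "s \<le> dim_row X"
  shows "pmf (volume_sampling X s) S = volume_prob X s S"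
proof -
  let ?P = "Pow {0..<dim_row X}"
  have nonneg: "volume_prob X s S \<ge> 0" for S
    using s det_gram_nonneg[of S X] det_gram_nonneg[of "{0..<dim_row X}" X]
    by (auto simp: volume_prob_gram)
  have "(\<Sum>S\<in>?P. volume_prob X s S)
      = (\<Sum>S | S \<subseteq> {0..<dim_row X} \<and> card S = s. volume_prob X s S)"
    by (intro sum.mono_neutral_right) (auto simp: volume_prob_def)
  also have "\<dots> = (\<Sum>S | S \<subseteq> {0..<dim_row X} \<and> card S = s. Determinant.det (gram X S)) /
      (real ((dim_row X - dim_col X) choose (s - dim_col X)) * Determinant.det (gram X {0..<dim_row X}))"
    by (simp add: volume_prob_gram sum_divide_distrib)
  also have "\<dots> = 1"
    using s nz sum_det_gram_subsets[of "{0..<dim_row X}" X s] by (simp add: gram_all_rows)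
  finally have sum1: "(\<Sum>S\<in>?P. volume_prob X s S) = 1" .
  have "(\<integral>\<^sup>+S. ennreal (volume_prob X s S) \<partial>count_space UNIV)
      = (\<Sum>S\<in>?P. ennreal (volume_prob X s S))"
    by (intro nn_integral_count_space') (auto simp: volume_prob_def)
  also have "\<dots> = 1"
    using sum1 by (simp add: sum_ennreal nonneg)
  finally show ?thesis
    unfolding volume_sampling_def by (intro pmf_embed_pmf nonneg)
qed

text \<open>The event of missing \<open>i\<close> is easier than that of containing it: its outcomes
  are all size \<open>s\<close> subsets of a smaller row set, so the subset sum formula applies
  again.\<close>

lemma prob_not_in_volume_sampling:
  assumes nz: "Determinant.det (transpose_mat X * X) \<noteq> 0"
    and s: "dim_col X \<le> s" "s \<le> dim_row X" and d: "dim_col X < dim_row X"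
    and i: "i < dim_row X"
  shows "measure_pmf.prob (volume_sampling X s) {S. i \<notin> S}
    = (real (dim_row X) - real s) / (real (dim_row X) - real (dim_col X)) * (1 - leverage_score X i)"
proof -
  let ?n = "dim_row X" and ?d = "dim_col X" and ?M = "volume_sampling X s"
  let ?T = "{0..<?n} - {i}" and ?G = "Determinant.det (transpose_mat X * X)"
  let ?P = "{S. S \<subseteq> ?T \<and> card S = s}"
  note pmf = pmf_volume_sampling[OF nz s]
  have T: "card ?T = ?n - 1" using i by simp
  \<comment> \<open>The event contains many sets that are not row sets of size \<open>s\<close>;
    they have probability 0, and on the support a finite family remains.\<close>
  have "{S. i \<notin> S} \<inter> set_pmf ?M = ?P \<inter> set_pmf ?M"
    by (auto simp: set_pmf_eq pmf volume_prob_def split: if_splits)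
  then have "measure_pmf.prob ?M {S. i \<notin> S} = measure_pmf.prob ?M ?P"
    by (metis measure_Int_set_pmf)
  also have "\<dots> = (\<Sum>S\<in>?P. volume_prob X s S)"
    by (simp add: measure_measure_pmf_finite pmf)
  also have "\<dots> = (\<Sum>S\<in>?P. Determinant.det (gram X S)) / (real ((?n - ?d) choose (s - ?d)) * ?G)"
    unfolding sum_divide_distrib
    by (intro sum.cong refl) (auto simp: volume_prob_gram gram_all_rows)
  \<comment> \<open>Strictness of \<open>d\<close> gives \<open>?T\<close> at least d elements, as
    the subset sum formula requires. For \<open>s\<close> equal to \<open>?n\<close> the upper
    binomial coefficient is 0.\<close>
  also have "\<dots> = real ((?n - 1 - ?d) choose (s - ?d)) * (1 - leverage_score X i) / real ((?n - ?d) choose (s - ?d))"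
    using sum_det_gram_subsets[of ?T X s] T s d nz det_gram_remove_leverage[OF nz i] by simp
  also have "real ((?n - 1 - ?d) choose (s - ?d))
      = real ((?n - ?d) choose (s - ?d)) * ((real ?n - real s) / (real ?n - real ?d))"
  proof -
    have *: "?n - s = (?n - ?d) - (s - ?d)" "?n - 1 - ?d = ?n - ?d - 1" using s d by auto
    have "(?n - s) * ((?n - ?d) choose (s - ?d)) = (?n - ?d) * ((?n - 1 - ?d) choose (s - ?d))"
      unfolding * by (rule binomial_absorb_comp)
    then have "(real ?n - real s) * real ((?n - ?d) choose (s - ?d))
        = (real ?n - real ?d) * real ((?n - 1 - ?d) choose (s - ?d))"
      using s d by (metis less_imp_le of_nat_diff of_nat_mult)
    then show ?thesis using d by (simp add: field_simps)
  qed
  finally show ?thesis using s by simp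
qed

theorem proposition2p4:
  fixes X :: "real mat" and n d s i :: nat
  assumes "X \<in> carrier_mat n d"
    and "d < n"
    and "vec_space.rank n X = d"
    and "s \<in> {d..n}"
    and "i \<in> {0..<n}"
  shows "measure_pmf.prob (volume_sampling X s) {S. i \<in> S} =
    (real s - real d) / (real n - real d)
    + (real n - real s) / (real n - real d) * leverage_score X i"
proof -
  have "{S. i \<in> S} = space (measure_pmf (volume_sampling X s)) - {S. i \<notin> S}" by auto
  then have "measure_pmf.prob (volume_sampling X s) {S. i \<in> S}
      = 1 - measure_pmf.prob (volume_sampling X s) {S. i \<notin> S}"
    by (metis measure_pmf.prob_compl sets_measure_pmf UNIV_I)
  also have "\<dots> = 1 - (real n - real s) / (real n - real d) * (1 - leverage_score X i)"
    using assms det_transpose_mult_self_nonzero[OF assms(1,3)]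
      prob_not_in_volume_sampling[of X s i] by auto
  finally have "measure_pmf.prob (volume_sampling X s) {S. i \<in> S}
      = 1 - (real n - real s) / (real n - real d) * (1 - leverage_score X i)" .
  \<comment> \<open>Here \<open>d < n\<close> matters: with a zero denominator both fractions would
    be 0 and the identity would read 0 = 1.\<close>
  moreover have "(real s - real d) / (real n - real d) = 1 - (real n - real s) / (real n - real d)"
    using assms(2) by (simp add: diff_divide_eq_iff)
  ultimately show ?thesis by (simp add: right_diff_distrib)
qed

end
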